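(* Let $P$ be a $\mathrm{TN}$-poset with a least element $\hat 0$, and let $Q$ be any finite $P$-positive poset. Then all zeros of the chain polynomial $$c_Q(t)=\sum_{C\text{ a chain in }Q}t^{|C|}$$ (the sum includes the empty chain) are real and located in the interval $[-1,0]$.
   Context: All posets here have a least element $\hat0$. Quasi-rank. For a locally finite poset $P$, $\rho(x)=\max\{k:x_0<\cdots<x_k=x,\ x_i\in P\}$ (assumed finite) is the quasi-rank function and $\rho(P)=\sup_x\rho(x)\in\mathbb{N}\cup\{\infty\}$ the (quasi-)rank. Write $\langle x\rangle=\{z\in P:z\le x\}$. $P$ is quasi-rank uniform if for all $x,y$ with $\rho(x)=\rho(y)$ and all $0\le k\le\rho(x)$, $|\{z\in\langle x\rangle:\rho(z)=k\}|=|\{z\in\langle y\rangle:\rho(z)=k\}|$ (finite). Then $r_{n,k}=|\{z\in\langle x\rangle:\rho(z)=k\}|$ for any $x$ with $\rho(x)=n$, and $R(P)=(r_{n,k})_{n,k=0}^N$, $N=\rho(P)$. A quasi-rank uniform poset is a $\mathrm{TN}$-poset if all minors of $R(P)$ are nonnegative. The polynomials $R_{n,k}(t)$. If $R=(r_{n,k})_{n,k=0}^N$ is a totally nonnegative lower triangular matrix with unit diagonal, there are a unique array of nonnegative numbers $(\lambda_{n,k})_{0\le k\le n<N}$ with the property that $\lambda_{n,k}=0$ implies $\lambda_{n+1,k}=0$ (for $0\le k\le n<N-1$), and a unique array of monic polynomials $(R_{n,k}(t))_{0\le k\le n\le N}$, such that $R_{n,0}(t)=\sum_{k=0}^n r_{n,k}t^k$,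 $R_{n,n}(t)=t^n$, $t^k$ divides $R_{n,k}(t)$, and $R_{n+1,k}(t)=R_{n+1,k+1}(t)+\lambda_{n,k}R_{n,k}(t)$ for $0\le k\le n<N$. $P$-positivity. Let $P$ be a $\mathrm{TN}$-poset, with $R_{n,k}(t)$ the polynomials associated to $R(P)$. A quasi-rank uniform poset $Q$ with quasi-rank function $\nu$ is a combinatorial $P$-poset if $\sum_{x\le_Q y}t^{\nu(x)}=R_{m,0}(t)$, $m=\nu(y)$, for every $y\in Q$ (in particular the rank of $Q$ is at most that of $P$). A combinatorial $P$-poset $Q$ of rank $r$ is $P$-positive if $f_Q(t)=\sum_{x\in Q}t^{\nu(x)}=\sum_{k=0}^r h_kR_{r,k}(t)$ for some real numbers $h_k\ge0$. *)

theory Defs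
  imports
    Complex_Main
    "HOL-Library.Extended_Nat"
    "HOL-Computational_Algebra.Polynomial"
    "Jordan_Normal_Form.Determinant"
begin

text \<open>
  A poset is a carrier set \<open>A\<close> with an order relation \<open>r\<close> on it, where \<open>(x, y) \<in> r\<close> means
  \<open>x \<le> y\<close>. The principal ideal generated by \<open>x\<close> is the library's \<open>under r x\<close>.
\<close>

subsection \<open>Quasi-rank\<close>

definition locally_finite_poset :: "'a set \<Rightarrow> 'a rel \<Rightarrow> bool" where
  "locally_finite_poset A r \<longleftrightarrow>
     partial_order_on A r \<and> r \<subseteq> A \<times> A \<and>
     (\<exists>bot\<in>A. \<forall>x\<in>A. (bot, x) \<in> r) \<and>
     (\<forall>x\<in>A. \<forall>y\<in>A. finite {z \<in> A. (x, z) \<in> r \<and> (z, y) \<in> r})"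

definition chain_lengths_below :: "'a set \<Rightarrow> 'a rel \<Rightarrow> 'a \<Rightarrow> nat set" where
  "chain_lengths_below A r x =
     {k. \<exists>c :: nat \<Rightarrow> 'a. (\<forall>i\<le>k. c i \<in> A) \<and>
           (\<forall>i<k. (c i, c (Suc i)) \<in> r \<and> c i \<noteq> c (Suc i)) \<and> c k = x}"

definition quasi_rank :: "'a set \<Rightarrow> 'a rel \<Rightarrow> 'a \<Rightarrow> nat" where
  "quasi_rank A r x = Max (chain_lengths_below A r x)"

definition poset_rank :: "'a set \<Rightarrow> 'a rel \<Rightarrow> enat" where
  "poset_rank A r = (SUP x\<in>A. enat (quasi_rank A r x))"

definition level_below :: "'a set \<Rightarrow> 'a rel \<Rightarrow> 'a \<Rightarrow> nat \<Rightarrow> 'a set" where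
  "level_below A r x k = {z \<in> under r x. quasi_rank A r z = k}"

text \<open>
  Given local finiteness and a least element, all principal ideals are finite. The finiteness
  clause below, which makes the maximum in \<^const>\<open>quasi_rank\<close> meaningful, is then
  automatic; it is stated because it is part of the definition of quasi-rank.
\<close>

definition quasi_rank_uniform :: "'a set \<Rightarrow> 'a rel \<Rightarrow> bool" where
  "quasi_rank_uniform A r \<longleftrightarrow>
     locally_finite_poset A r \<and>
     (\<forall>x\<in>A. finite (chain_lengths_below A r x)) \<and>
     (\<forall>x\<in>A. \<forall>y\<in>A. quasi_rank A r x = quasi_rank A r y \<longrightarrow>
        (\<forall>k\<le>quasi_rank A r x.
           card (level_below A r x k) = card (level_below A r y k)))"

text \<open>
  The entry is meaningful for \<open>n \<le> poset_rank A r\<close>, when an element of quasi-rank \<open>n\<close> exists;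
  by uniformity it does not depend on the chosen element.
\<close>

definition rank_matrix :: "'a set \<Rightarrow> 'a rel \<Rightarrow> nat \<Rightarrow> nat \<Rightarrow> real" where
  "rank_matrix A r n k =
     real (card (level_below A r (SOME x. x \<in> A \<and> quasi_rank A r x = n) k))"

subsection \<open>Totally nonnegative matrices\<close>

text \<open>
  A matrix with rows and columns indexed by \<open>0, \<dots>, N\<close>, where \<open>N\<close> may be \<open>\<infinity>\<close>, is a function
  on pairs of naturals of which only the entries with indices at most \<open>N\<close> matter.
\<close>

definition totally_nonnegative :: "enat \<Rightarrow> (nat \<Rightarrow> nat \<Rightarrow> real) \<Rightarrow> bool" where
  "totally_nonnegative N M \<longleftrightarrow>
     (\<forall>(m::nat) (I :: nat \<Rightarrow> nat) (J :: nat \<Rightarrow> nat).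
        strict_mono_on {..<m} I \<and> strict_mono_on {..<m} J \<and>
        (\<forall>i<m. enat (I i) \<le> N \<and> enat (J i) \<le> N) \<longrightarrow>
        det (mat m m (\<lambda>(i, j). M (I i) (J j))) \<ge> 0)"

definition TN_poset :: "'a set \<Rightarrow> 'a rel \<Rightarrow> bool" where
  "TN_poset A r \<longleftrightarrow>
     quasi_rank_uniform A r \<and> totally_nonnegative (poset_rank A r) (rank_matrix A r)"

subsection \<open>The polynomials associated to a totally nonnegative matrix\<close>

definition is_R_array ::
  "enat \<Rightarrow> (nat \<Rightarrow> nat \<Rightarrow> real) \<Rightarrow> (nat \<Rightarrow> nat \<Rightarrow> real) \<Rightarrow> (nat \<Rightarrow> nat \<Rightarrow> real poly) \<Rightarrow> bool" where
  "is_R_array N M lam R \<longleftrightarrow>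
     (\<forall>n k. k \<le> n \<and> enat n < N \<longrightarrow> lam n k \<ge> 0) \<and>
     (\<forall>n k. k \<le> n \<and> enat (Suc n) < N \<and> lam n k = 0 \<longrightarrow> lam (Suc n) k = 0) \<and>
     (\<forall>n k. k \<le> n \<and> enat n \<le> N \<longrightarrow> lead_coeff (R n k) = 1 \<and> [:0, 1:] ^ k dvd R n k) \<and>
     (\<forall>n. enat n \<le> N \<longrightarrow>
        R n 0 = (\<Sum>k\<le>n. smult (M n k) ([:0, 1:] ^ k)) \<and> R n n = [:0, 1:] ^ n) \<and>
     (\<forall>n k. k \<le> n \<and> enat n < N \<longrightarrow>
        R (Suc n) k = R (Suc n) (Suc k) + smult (lam n k) (R n k))"

text \<open>
  For a totally nonnegative lower triangular \<open>M\<close> with unit diagonal, such arrays exist and are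
  unique in the index range \<open>k \<le> n \<le> N\<close>, so the choice only affects the irrelevant values
  outside this range.
\<close>

definition R_poly :: "enat \<Rightarrow> (nat \<Rightarrow> nat \<Rightarrow> real) \<Rightarrow> nat \<Rightarrow> nat \<Rightarrow> real poly" where
  "R_poly N M = (SOME R. \<exists>lam. is_R_array N M lam R)"

definition poset_R_poly :: "'a set \<Rightarrow> 'a rel \<Rightarrow> nat \<Rightarrow> nat \<Rightarrow> real poly" where
  "poset_R_poly A r = R_poly (poset_rank A r) (rank_matrix A r)"

subsection \<open>Positivity\<close>

definition combinatorial_poset :: "'a set \<Rightarrow> 'a rel \<Rightarrow> 'b set \<Rightarrow> 'b rel \<Rightarrow> bool" where
  "combinatorial_poset P leP Q leQ \<longleftrightarrow>
     quasi_rank_uniform Q leQ \<and>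
     poset_rank Q leQ \<le> poset_rank P leP \<and>
     (\<forall>y\<in>Q. (\<Sum>x\<in>under leQ y. [:0, 1:] ^ quasi_rank Q leQ x) =
              poset_R_poly P leP (quasi_rank Q leQ y) 0)"

definition f_poly :: "'b set \<Rightarrow> 'b rel \<Rightarrow> real poly" where
  "f_poly Q leQ = (\<Sum>x\<in>Q. [:0, 1:] ^ quasi_rank Q leQ x)"

text \<open>Finiteness of \<open>Q\<close> is implicit in \<^const>\<open>f_poly\<close> being a polynomial.\<close>

definition P_positive :: "'a set \<Rightarrow> 'a rel \<Rightarrow> 'b set \<Rightarrow> 'b rel \<Rightarrow> bool" where
  "P_positive P leP Q leQ \<longleftrightarrow>
     combinatorial_poset P leP Q leQ \<and> finite Q \<and>
     (\<exists>(rk::nat) (h :: nat \<Rightarrow> real).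
        poset_rank Q leQ = enat rk \<and> (\<forall>k\<le>rk. h k \<ge> 0) \<and>
        f_poly Q leQ = (\<Sum>k\<le>rk. smult (h k) (poset_R_poly P leP rk k)))"

definition chain_poly :: "'b set \<Rightarrow> 'b rel \<Rightarrow> real poly" where
  "chain_poly Q leQ = (\<Sum>C | C \<subseteq> Q \<and> C \<in> Chains leQ. [:0, 1:] ^ card C)"

end

theory Submission
  imports Defs
begin

text \<open>
  The polynomials \<open>R\<^sub>n\<^sub>,\<^sub>k\<close> come from Neville elimination of the rank matrix. Let \<open>L\<close> be the linear
  functional sending \<open>t ^ n\<close> to the generating function (in \<open>z\<close>) of the chains avoiding the least
  element whose maximum has quasi-rank \<open>n\<close>, and put \<open>f\<^sub>n\<^sub>,\<^sub>k = L R\<^sub>n\<^sub>,\<^sub>k\<close>. The recursion of the \<open>R\<^sub>n\<^sub>,\<^sub>k\<close>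
  turns into the identity that \<open>f\<close> at \<open>(n + 1, k)\<close> is
  \<open>z * (\<Sum>j<k. \<lambda>\<^sub>n\<^sub>,\<^sub>j * f\<^sub>n\<^sub>,\<^sub>j) + (1 + z) * (\<Sum>j=k..n. \<lambda>\<^sub>n\<^sub>,\<^sub>j * f\<^sub>n\<^sub>,\<^sub>j)\<close>. For \<open>z\<close> in the upper half plane this
  preserves the property that the \<open>f\<^sub>n\<^sub>,\<^sub>k\<close> are nonzero and turn counterclockwise with \<open>k\<close>, by a total
  angle of at most \<open>arg z - arg (1 + z) < \<pi>\<close>. So no nontrivial nonnegative combination of them
  vanishes. For real \<open>z\<close> outside \<open>[-1, 0]\<close> all the \<open>f\<^sub>n\<^sub>,\<^sub>k\<close> with the same \<open>n\<close> have the same sign. The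
  chain polynomial at \<open>z\<close> is \<open>1 + z\<close> times such a combination.
\<close>

subsection \<open>Neville elimination\<close>

text \<open>
  Elimination visibly preserves the nonnegativity of minors with consecutive rows, and these
  minors are all that is needed to see that the multipliers are nonnegative. Rows and columns below
  \<open>k\<close> are the ones already eliminated.
\<close>

definition consecutive_TN :: "enat \<Rightarrow> nat \<Rightarrow> (nat \<Rightarrow> nat \<Rightarrow> real) \<Rightarrow> bool" where
  "consecutive_TN N k A \<longleftrightarrow>
     (\<forall>n j. k \<le> n \<longrightarrow> enat n \<le> N \<longrightarrow> j < k \<or> n < j \<longrightarrow> A n j = 0) \<and>
     (\<forall>n. k \<le> n \<longrightarrow> enat n \<le> N \<longrightarrow> A n n = 1) \<and>
     (\<forall>m i J. k \<le> i \<longrightarrow> (\<forall>p<m. enat (i + p) \<le> N) \<longrightarrow> strict_mono_on {..<m} J \<longrightarrow>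
        (\<forall>p<m. k \<le> J p \<and> enat (J p) \<le> N) \<longrightarrow> 0 \<le> det (mat m m (\<lambda>(p, q). A (i + p) (J q))))"

text \<open>Each row loses a multiple of the unmodified row directly above it. Over a zero pivot the
  quotient is 0 by the convention for division, and the row stays unchanged.\<close>

definition neville_step :: "nat \<Rightarrow> (nat \<Rightarrow> nat \<Rightarrow> real) \<Rightarrow> nat \<Rightarrow> nat \<Rightarrow> real" where
  "neville_step k A n j = A n j - A n k / A (n - 1) k * A (n - 1) j"

lemma consecutive_TN_zero: "consecutive_TN N k A \<Longrightarrow> k \<le> n \<Longrightarrow> enat n \<le> N \<Longrightarrow> j < k \<or> n < j \<Longrightarrow> A n j = 0"
  and consecutive_TN_diag: "consecutive_TN N k A \<Longrightarrow> k \<le> n \<Longrightarrow> enat n \<le> N \<Longrightarrow> A n n = 1"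
  and consecutive_TN_minor: "consecutive_TN N k A \<Longrightarrow> k \<le> i \<Longrightarrow> (\<And>p. p < m \<Longrightarrow> enat (i + p) \<le> N) \<Longrightarrow>
    strict_mono_on {..<m} J \<Longrightarrow> (\<And>p. p < m \<Longrightarrow> k \<le> J p \<and> enat (J p) \<le> N) \<Longrightarrow>
    0 \<le> det (mat m m (\<lambda>(p, q). A (i + p) (J q)))"
  unfolding consecutive_TN_def by blast+

lemma consecutive_TN_nonneg:
  assumes "consecutive_TN N k A" "k \<le> n" "enat n \<le> N" "k \<le> j" "enat j \<le> N"
  shows "0 \<le> A n j"
  using consecutive_TN_minor[OF assms(1,2), of 1 "\<lambda>_. j"] assms
  by (simp add: det_single monotone_on_def)

text \<open>Once \<open>A n k = 0\<close>, the minor on rows \<open>n\<close>, \<open>Suc n\<close>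
  and columns \<open>k\<close>, \<open>n\<close> equals \<open>- A (Suc n) k\<close>, since
  \<open>A n n = 1\<close>. So zeros in the pivot column spread downwards, which makes a zero pivot
  harmless.\<close>

lemma consecutive_TN_pivot_zero:
  assumes A: "consecutive_TN N k A" and n: "k \<le> n" "enat (Suc n) \<le> N" and 0: "A n k = 0"
  shows "A (Suc n) k = 0"
proof -
  have nN: "enat n \<le> N" using n by (metis Suc_ile_eq order_less_imp_le)
  have kn: "k < n" using consecutive_TN_diag[OF A n(1) nN] n 0 by (cases "k = n") auto
  then have kN: "enat k \<le> N" using nN by (metis enat_ord_simps(1) order_less_imp_le order_trans)
  define J where "J p = (if p = 0 then k else n)" for p :: nat
  have "0 \<le> det (mat 2 2 (\<lambda>(p, q). A (n + p) (J q)))"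
    using kn nN kN n
    by (intro consecutive_TN_minor[OF A]) (auto simp: strict_mono_on_def J_def less_2_cases_iff)
  also have "\<dots> = A n k * A (Suc n) n - A n n * A (Suc n) k"
    by (subst laplace_expansion_column[of _ 2 0])
      (auto simp: J_def numeral_2_eq_2 cofactor_def mat_delete_def det_single)
  finally have "A (Suc n) k \<le> 0"
    using 0 consecutive_TN_diag[OF A n(1) nN] by simp
  moreover have "0 \<le> A (Suc n) k"
    using consecutive_TN_nonneg[OF A _ n(2) _ kN] n by simp
  ultimately show ?thesis by simp
qed

text \<open>The new matrix is \<open>L * B\<close> for a lower bidiagonal \<open>L\<close> with unit
  diagonal.\<close>

lemma det_subtract_previous_rows:
  fixes B :: "real mat"
  assumes B: "B \<in> carrier_mat n n"
  shows "det (mat n n (\<lambda>(p, q). if p = 0 then B $$ (p, q) else B $$ (p, q) - c p * B $$ (p - 1, q))) = det B"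
    (is "det ?B' = _")
proof -
  define L where "L = mat n n (\<lambda>(p, q). if p = q then 1 else if p = Suc q then - c p else 0)"
  have L: "L \<in> carrier_mat n n" by (simp add: L_def)
  have "det L = prod_list (diag_mat L)"
    by (rule det_lower_triangular[OF _ L]) (auto simp: L_def)
  also have "diag_mat L = replicate n 1"
    by (auto simp: diag_mat_def L_def intro!: nth_equalityI)
  finally have "det L = 1" by simp
  moreover have "?B' = L * B"
  proof (rule eq_matI)
    fix p q assume "p < dim_row (L * B)" "q < dim_col (L * B)"
    then have p: "p < n" and q: "q < n" using L B by auto
    have "(L * B) $$ (p, q) = (\<Sum>s<n. L $$ (p, s) * B $$ (s, q))"
      using p q L B by (auto simp: scalar_prod_def lessThan_atLeast0)
    also have "\<dots> = (\<Sum>s<n. (if s = p then B $$ (p, q) else 0) - (if Suc s = p then c p * B $$ (p - 1, q) else 0))"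
      using p by (intro sum.cong) (auto simp: L_def)
    also have "\<dots> = B $$ (p, q) - (\<Sum>s<n. if Suc s = p then c p * B $$ (p - 1, q) else 0)"
      using p by (simp add: sum_subtractf)
    also have "(\<Sum>s<n. if Suc s = p then c p * B $$ (p - 1, q) else 0) = (if p = 0 then 0 else c p * B $$ (p - 1, q))"
      using p by (cases p) auto
    finally show "?B' $$ (p, q) = (L * B) $$ (p, q)"
      using p q by auto
  qed (use L B in auto)
  ultimately show ?thesis using det_mult[OF L B] by simp
qed

text \<open>
  A minor after the step is, up to the positive pivot above its first row, the minor before the
  step with that row and the pivot column added.
\<close>

lemma consecutive_TN_neville_step:
  assumes A: "consecutive_TN N k A"
  shows "consecutive_TN N (Suc k) (neville_step k A)"
proof -
  have pred: "k \<le> n - 1" "enat (n - 1) \<le> N" if "Suc k \<le> n" "enat n \<le> N" for n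
    using that by (auto intro: order_trans[of _ "enat n"])
  have elim: "neville_step k A n k = 0" if n: "Suc k \<le> n" "enat n \<le> N" for n
    using consecutive_TN_pivot_zero[OF A, of "n - 1"] pred[OF n] n
    by (cases "A (n - 1) k = 0") (auto simp: neville_step_def)
  show ?thesis
    unfolding consecutive_TN_def
  proof (intro conjI allI impI)
    fix n j assume n: "Suc k \<le> n" "enat n \<le> N" and j: "j < Suc k \<or> n < j"
    show "neville_step k A n j = 0"
    proof (cases "j = k")
      case False
      then show ?thesis
        using consecutive_TN_zero[OF A, of n j] consecutive_TN_zero[OF A, of "n - 1" j] n j pred[OF n]
        by (auto simp: neville_step_def)
    qed (use elim n in simp)
  next
    fix n assume n: "Suc k \<le> n" "enat n \<le> N"
    show "neville_step k A n n = 1"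
      using consecutive_TN_zero[OF A, of "n - 1" n] consecutive_TN_diag[OF A, of n] n pred[OF n]
      by (auto simp: neville_step_def)
  next
    fix m i J
    assume i: "Suc k \<le> i" and rows: "\<forall>p<m. enat (i + p) \<le> N" and J: "strict_mono_on {..<m} J"
      and cols: "\<forall>p<m. Suc k \<le> J p \<and> enat (J p) \<le> N"
    let ?A' = "mat m m (\<lambda>(p, q). neville_step k A (i + p) (J q))"
    consider "m = 0" | "0 < m" "A (i - 1) k = 0" | "0 < m" "A (i - 1) k \<noteq> 0" by auto
    then show "0 \<le> det ?A'"
    proof cases
      case 1
      then show ?thesis by (simp add: det_dim_zero[OF mat_carrier])
    next
      case 2
      \<comment> \<open>The pivot column vanishes from row \<open>i - 1\<close> on, so the step
        leaves the rows of this minor unchanged.\<close>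
      have "A (i - 1 + p) k = 0" if "p \<le> m" for p
        using that
      proof (induction p)
        case (Suc p)
        then show ?case
          using consecutive_TN_pivot_zero[OF A, of "i - 1 + p"] i rows by (auto simp: less_eq_Suc_le)
      qed (use 2 in simp)
      from this[of "Suc _"] have "?A' = mat m m (\<lambda>(p, q). A (i + p) (J q))"
        using i by (intro eq_matI) (auto simp: neville_step_def)
      also have "0 \<le> det \<dots>"
        using i rows J cols by (intro consecutive_TN_minor[OF A]) auto
      finally show ?thesis .
    next
      case 3
      define J' where "J' q = (case q of 0 \<Rightarrow> k | Suc q \<Rightarrow> J q)" for q
      have iN: "enat i \<le> N" using 3 rows by force
      have kN: "enat k \<le> N" using pred[OF i iN] by (metis enat_ord_simps(1) order_trans)
      define B where "B = mat (Suc m) (Suc m) (\<lambda>(p, q). A (i - 1 + p) (J' q))"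
      define c where "c p = A (i - 1 + p) k / A (i - 1 + p - 1) k" for p
      define B' where "B' = mat (Suc m) (Suc m) (\<lambda>(p, q). if p = 0 then B $$ (p, q) else B $$ (p, q) - c p * B $$ (p - 1, q))"
      have B: "B \<in> carrier_mat (Suc m) (Suc m)" by (simp add: B_def)
      have B': "B' \<in> carrier_mat (Suc m) (Suc m)" by (simp add: B'_def)
      have B'_Suc: "B' $$ (Suc p, q) = neville_step k A (i + p) (J' q)" if "p < m" "q < Suc m" for p q
        using that i by (simp add: B'_def B_def c_def neville_step_def)
      have "strict_mono_on {..<Suc m} J'"
        using J cols by (auto simp: strict_mono_on_def J'_def less_eq_Suc_le split: nat.splits)
      then have "0 \<le> det B"
        unfolding B_def using i rows cols kN pred[OF i iN]
        by (intro consecutive_TN_minor[OF A]) (auto simp: J'_def[of "Suc _"] J'_def[of 0] less_Suc_eq_0_disj)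
      also have "det B = det B'"
        using det_subtract_previous_rows[OF B, of c] by (simp add: B'_def)
      \<comment> \<open>The first column is cleared below the pivot, so only the top term of the
        expansion survives.\<close>
      also have "\<dots> = (\<Sum>p<Suc m. B' $$ (p, 0) * cofactor B' p 0)"
        by (rule laplace_expansion_column[OF B']) simp
      also have "\<dots> = B' $$ (0, 0) * cofactor B' 0 0 + (\<Sum>p<m. B' $$ (Suc p, 0) * cofactor B' (Suc p) 0)"
        by (simp add: sum.lessThan_Suc_shift del: sum.lessThan_Suc)
      also have "(\<Sum>p<m. B' $$ (Suc p, 0) * cofactor B' (Suc p) 0) = 0"
        using elim i rows by (intro sum.neutral) (auto simp: B'_Suc J'_def)
      also have "B' $$ (0, 0) = A (i - 1) k"
        by (simp add: B'_def B_def J'_def)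
      also have "cofactor B' 0 0 = det (mat_delete B' 0 0)"
        by (simp add: cofactor_def)
      also have "mat_delete B' 0 0 = ?A'"
        using B' by (intro eq_matI) (auto simp: mat_delete_def B'_Suc J'_def)
      finally have "0 \<le> A (i - 1) k * det ?A'" by simp
      moreover have "0 < A (i - 1) k"
        using consecutive_TN_nonneg[OF A, of "i - 1" k] pred[OF i iN] kN 3 by simp
      ultimately show ?thesis by (simp add: zero_le_mult_iff)
    qed
  qed
qed

section \<open>Existence of the polynomials by iterated elimination\<close>

primrec neville :: "(nat \<Rightarrow> nat \<Rightarrow> real) \<Rightarrow> nat \<Rightarrow> nat \<Rightarrow> nat \<Rightarrow> real" where
  "neville M 0 = M"
| "neville M (Suc k) = neville_step k (neville M k)"

lemma consecutive_TN_neville: "consecutive_TN N 0 M \<Longrightarrow> consecutive_TN N k (neville M k)"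
  by (induction k) (auto intro: consecutive_TN_neville_step)

lemma X_power_eq_monom: "[:0, 1:] ^ n = monom (1::'a::comm_semiring_1) n"
  by (simp add: monom_altdef)

text \<open>Row \<open>n\<close> after \<open>k\<close> steps lists the coefficients of
  \<open>R n k\<close>, and \<open>lam n k\<close> is the multiplier that the next step uses on row
  \<open>Suc n\<close>. The recursion is then the definition of a step.\<close>

lemma is_R_array_exists:
  assumes M: "consecutive_TN N 0 M"
  shows "\<exists>R lam. is_R_array N M lam R"
proof -
  note A = consecutive_TN_neville[OF M]
  define R where "R n k = (\<Sum>j\<le>n. monom (neville M k n j) j)" for n k
  define lam where "lam n k = neville M k (Suc n) k / neville M k n k" for n k
  have coeff_R: "coeff (R n k) i = (if i \<le> n then neville M k n i else 0)" for n k i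
    by (simp add: R_def coeff_sum)
  have less: "enat (Suc n) \<le> N" "enat n \<le> N" if "enat n < N" for n
    using that by (auto simp: Suc_ile_eq)
  have "is_R_array N M lam R"
    unfolding is_R_array_def
  proof (intro conjI allI impI; (elim conjE)?)
    fix n k assume nk: "k \<le> n" "enat n < N"
    moreover have "enat k \<le> N"
      using nk less(2) by (metis enat_ord_simps(1) order_trans)
    ultimately show "0 \<le> lam n k"
      unfolding lam_def using less
      by (intro divide_nonneg_nonneg consecutive_TN_nonneg[OF A[of k]]) auto
  next
    fix n k assume nk: "k \<le> n" "enat (Suc n) < N" and 0: "lam n k = 0"
    \<comment> \<open>Either the numerator of \<open>lam n k\<close> is zero, or the denominator is
      and the zero spreads down to the numerator. This entry is the denominator of
      \<open>lam (Suc n) k\<close>, which is thus 0 by convention.\<close>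
    then have "neville M k (Suc n) k = 0"
      using consecutive_TN_pivot_zero[OF A, of k n] by (auto simp: lam_def)
    then show "lam (Suc n) k = 0" by (simp add: lam_def)
  next
    fix n k assume nk: "k \<le> n" "enat n \<le> N"
    have 1: "coeff (R n k) n = 1"
      using consecutive_TN_diag[OF A nk] by (simp add: coeff_R)
    then have "n \<le> degree (R n k)" by (intro le_degree) simp
    moreover have "degree (R n k) \<le> n" by (intro degree_le) (simp add: coeff_R)
    ultimately show "lead_coeff (R n k) = 1" using 1 by simp
    show "[:0, 1:] ^ k dvd R n k"
      unfolding X_power_eq_monom monom_1_dvd_iff'
      using consecutive_TN_zero[OF A nk] by (auto simp: coeff_R)
  next
    fix n assume n: "enat n \<le> N"
    show "R n 0 = (\<Sum>k\<le>n. smult (M n k) ([:0, 1:] ^ k))"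
      by (simp add: R_def X_power_eq_monom smult_monom)
    show "R n n = [:0, 1:] ^ n"
      unfolding X_power_eq_monom
      using consecutive_TN_zero[OF A _ n] consecutive_TN_diag[OF A _ n]
      by (intro poly_eqI) (auto simp: coeff_R)
  next
    fix n k assume nk: "k \<le> n" "enat n < N"
    \<comment> \<open>The coefficient ranges of rows \<open>n\<close> and \<open>Suc n\<close>
      differ in this one column.\<close>
    have "neville M k n (Suc n) = 0"
      using consecutive_TN_zero[OF A nk(1) less(2)[OF nk(2)]] by simp
    then show "R (Suc n) k = R (Suc n) (Suc k) + smult (lam n k) (R n k)"
      by (intro poly_eqI) (auto simp: coeff_R lam_def neville_step_def le_Suc_eq)
  qed
  then show ?thesis by blast
qed

lemma totally_nonnegative_imp_consecutive_TN:
  assumes "totally_nonnegative N M" "\<And>n j. enat n \<le> N \<Longrightarrow> n < j \<Longrightarrow> M n j = 0"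
    "\<And>n. enat n \<le> N \<Longrightarrow> M n n = 1"
  shows "consecutive_TN N 0 M"
  unfolding consecutive_TN_def
proof (intro conjI allI impI)
  fix m i and J :: "nat \<Rightarrow> nat"
  assume "\<forall>p<m. enat (i + p) \<le> N" "strict_mono_on {..<m} J" "\<forall>p<m. 0 \<le> J p \<and> enat (J p) \<le> N"
  then show "0 \<le> det (mat m m (\<lambda>(p, q). M (i + p) (J q)))"
    using assms(1)[unfolded totally_nonnegative_def, rule_format, of m "\<lambda>p. i + p" J]
    by (auto simp: strict_mono_on_def)
qed (use assms in auto)

subsection \<open>Nonvanishing outside the interval\<close>

text \<open>
  For \<open>z\<close> in the upper half plane and nonzero \<open>a\<close>, \<open>b\<close> this says that
  \<open>0 \<le> arg (b / a) \<le> arg z - arg (1 + z)\<close>.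
\<close>

definition arg_between :: "complex \<Rightarrow> complex \<Rightarrow> complex \<Rightarrow> bool" where
  "arg_between z a b \<longleftrightarrow> 0 \<le> Im (b * cnj a) \<and> 0 \<le> Im (z * a * cnj ((1 + z) * b))"

lemma arg_between_refl: "0 \<le> Im z \<Longrightarrow> arg_between z a a"
proof -
  assume "0 \<le> Im z"
  moreover have "Im (z * a * cnj ((1 + z) * a)) = Im z * (Re a ^ 2 + Im a ^ 2)"
    by (simp add: algebra_simps power2_eq_square)
  ultimately show ?thesis
    by (simp add: arg_between_def)
qed

text \<open>Both inequalities are linear over the reals in \<open>a\<close> and in \<open>b\<close>,
  so the relation passes to nonnegative combinations on either side. As 0 is related to everything,
  nonvanishing has to be tracked separately.\<close>

lemma arg_between_sum_left:
  assumes "\<And>i. i \<in> I \<Longrightarrow> arg_between z (f i) b" "\<And>i. i \<in> I \<Longrightarrow> 0 \<le> c i"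
  shows "arg_between z (\<Sum>i\<in>I. complex_of_real (c i) * f i) b"
proof -
  have "Im (b * cnj (\<Sum>i\<in>I. complex_of_real (c i) * f i)) = (\<Sum>i\<in>I. c i * Im (b * cnj (f i)))"
    by (simp add: sum_distrib_left sum_distrib_right sum_subtractf algebra_simps sum.distrib)
  moreover have "Im (z * (\<Sum>i\<in>I. complex_of_real (c i) * f i) * w) = (\<Sum>i\<in>I. c i * Im (z * f i * w))" for w
    unfolding sum_distrib_left sum_distrib_right Im_sum
    by (intro sum.cong refl) (simp add: algebra_simps)
  ultimately show ?thesis
    using assms by (auto simp: arg_between_def intro!: sum_nonneg mult_nonneg_nonneg simp del: times_complex.sel)
qed

lemma arg_between_sum_right:
  assumes "\<And>i. i \<in> I \<Longrightarrow> arg_between z a (f i)" "\<And>i. i \<in> I \<Longrightarrow> 0 \<le> c i"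
  shows "arg_between z a (\<Sum>i\<in>I. complex_of_real (c i) * f i)"
proof -
  have "Im ((\<Sum>i\<in>I. complex_of_real (c i) * f i) * cnj a) = (\<Sum>i\<in>I. c i * Im (f i * cnj a))"
    by (simp add: sum_distrib_left sum_distrib_right sum_subtractf algebra_simps sum.distrib)
  moreover have "Im (z * a * cnj ((1 + z) * (\<Sum>i\<in>I. complex_of_real (c i) * f i)))
      = (\<Sum>i\<in>I. c i * Im (z * a * cnj ((1 + z) * f i)))"
    unfolding cnj_sum complex_cnj_mult sum_distrib_left sum_distrib_right Im_sum
    by (intro sum.cong refl) (simp add: algebra_simps)
  ultimately show ?thesis
    using assms by (auto simp: arg_between_def intro!: sum_nonneg mult_nonneg_nonneg simp del: times_complex.sel)
qed

text \<open>For nonzero values, \<open>(1 + z) * (b / a)\<close> and \<open>z * (a / b)\<close> both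
  have arguments between \<open>arg (1 + z)\<close> and \<open>arg z\<close>. The computation in
  coordinates also covers zero.\<close>

lemma arg_betweenD:
  assumes "0 < Im z" "arg_between z a b"
  shows "0 \<le> Im ((1 + z) * b * cnj a)" "0 \<le> Im (z * a * cnj b)"
proof -
  define w where "w = b * cnj a"
  have 1: "0 \<le> Im w" using assms by (simp add: arg_between_def w_def)
  have "0 \<le> Im (z * cnj (1 + z) * cnj w)"
    using assms by (simp add: arg_between_def w_def ac_simps)
  then have 2: "(Re z + (Re z ^ 2 + Im z ^ 2)) * Im w \<le> Im z * Re w"
    by (simp add: algebra_simps power2_eq_square)
  have "Im ((1 + z) * w) = (1 + Re z) * Im w + Im z * Re w"
    by simp
  also have "\<dots> \<ge> (1 + Re z) * Im w + (Re z + (Re z ^ 2 + Im z ^ 2)) * Im w"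
    using 2 by simp
  also have "(1 + Re z) * Im w + (Re z + (Re z ^ 2 + Im z ^ 2)) * Im w = ((1 + Re z)\<^sup>2 + (Im z)\<^sup>2) * Im w"
    by (simp add: algebra_simps power2_eq_square)
  finally show "0 \<le> Im ((1 + z) * b * cnj a)"
    using 1 by (smt (verit, ccfv_SIG) mult.assoc mult_nonneg_nonneg w_def zero_le_power2)
  have "Im (z * cnj w) = Im z * Re w - Re z * Im w"
    by simp
  also have "\<dots> \<ge> (Re z ^ 2 + Im z ^ 2) * Im w"
    using 2 by (simp add: algebra_simps)
  finally show "0 \<le> Im (z * a * cnj b)"
    using 1 by (smt (verit, ccfv_SIG) complex_cnj_cnj complex_cnj_mult mult.assoc mult.commute mult_nonneg_nonneg w_def zero_le_power2)
qed

lemma Im_of_real_mult: "Im (complex_of_real r * w) = r * Im w"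
  by simp

text \<open>For \<open>a\<close>, \<open>b\<close>, \<open>c\<close> the weighted sums over
  \<open>j < k\<close>, \<open>k \<le> j < l\<close> and \<open>l \<le> j\<close>, the two sides are
  the next values at \<open>k\<close> and \<open>l\<close>. They differ only in the factor of the
  middle block.\<close>

lemma arg_between_step:
  assumes z: "0 < Im z" and ab: "arg_between z a b" and bc: "arg_between z b c" and ac: "arg_between z a c"
  shows "arg_between z (z * a + (1 + z) * b + (1 + z) * c) (z * a + z * b + (1 + z) * c)"
    (is "arg_between z ?F ?G")
proof -
  \<comment> \<open>Since \<open>?F = ?G + b\<close>, the left side is
    \<open>Im (?G * cnj b)\<close>.\<close>
  have "Im (?G * cnj ?F) = Im z * (Re b ^ 2 + Im b ^ 2) + Im (z * a * cnj b) + Im ((1 + z) * c * cnj b)"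
    by (simp add: algebra_simps power2_eq_square)
  then have 1: "0 \<le> Im (?G * cnj ?F)"
    using arg_betweenD(2)[OF z ab] arg_betweenD(1)[OF z bc] z by simp
  \<comment> \<open>Here \<open>?F = d + (1 + z) * b\<close> and \<open>?G = d + z * b\<close>;
    eliminating \<open>b\<close> expresses \<open>z * ?F\<close> through \<open>?G\<close> and
    \<open>d\<close>.\<close>
  define d where "d = z * a + (1 + z) * c"
  have G: "?G = d + z * b"
    by (simp add: d_def)
  have "z * ?F = (1 + z) * ?G - d"
    by (simp add: algebra_simps d_def)
  then have "Im (z * ?F * cnj ((1 + z) * ?G)) = Im (((1 + z) * ?G - d) * cnj ((1 + z) * ?G))"
    by (simp only:)
  also have "\<dots> = Im ((1 + z) * ?G * cnj d)"
    by (simp add: algebra_simps)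
  also have "\<dots> = Im ((1 + z) * (d + z * b) * cnj d)"
    by (simp only: G)
  also have "Im ((1 + z) * (d + z * b) * cnj d) = Im z * (Re d ^ 2 + Im d ^ 2) + Im ((1 + z) * (z * b) * cnj d)"
    by (simp add: algebra_simps power2_eq_square)
  also have "(1 + z) * (z * b) * cnj d = complex_of_real (cmod z ^ 2) * ((1 + z) * b * cnj a)
      + complex_of_real (cmod (1 + z) ^ 2) * (z * b * cnj c)"
    unfolding complex_norm_square d_def by (simp add: algebra_simps)
  finally have "Im (z * ?F * cnj ((1 + z) * ?G)) = Im z * (Re d ^ 2 + Im d ^ 2)
      + (cmod z ^ 2 * Im ((1 + z) * b * cnj a) + cmod (1 + z) ^ 2 * Im (z * b * cnj c))"
    by (simp only: plus_complex.sel(2) Im_of_real_mult)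
  then have "0 \<le> Im (z * ?F * cnj ((1 + z) * ?G))"
    using arg_betweenD(1)[OF z ab] arg_betweenD(2)[OF z bc] z by simp
  with 1 show ?thesis by (simp only: arg_between_def)
qed

text \<open>Multiply the sum by \<open>(1 + z) * cnj (f i)\<close>, with \<open>i\<close> the first
  index of nonzero weight. No term gets a negative imaginary part, and the factor
  \<open>1 + z\<close> makes that of term \<open>i\<close> strictly positive.\<close>

lemma nonneg_combination_nonzero:
  fixes h :: "nat \<Rightarrow> real"
  assumes z: "0 < Im z" and f: "\<And>i j. i \<le> j \<Longrightarrow> j \<le> n \<Longrightarrow> arg_between z (f i) (f j)"
    and nz: "\<And>i. i \<le> n \<Longrightarrow> f i \<noteq> 0"
    and h: "\<And>i. i \<le> n \<Longrightarrow> 0 \<le> h i" and ex: "\<exists>i\<le>n. h i \<noteq> 0"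
  shows "(\<Sum>i\<le>n. complex_of_real (h i) * f i) \<noteq> 0"
proof
  assume sum0: "(\<Sum>i\<le>n. complex_of_real (h i) * f i) = 0"
  define i where "i = (LEAST i. i \<le> n \<and> h i \<noteq> 0)"
  have i: "i \<le> n" "h i \<noteq> 0" and min: "\<And>j. j \<le> n \<Longrightarrow> h j \<noteq> 0 \<Longrightarrow> i \<le> j"
    using LeastI_ex[of "\<lambda>i. i \<le> n \<and> h i \<noteq> 0"] ex Least_le[of "\<lambda>i. i \<le> n \<and> h i \<noteq> 0"]
    unfolding i_def by auto
  have "0 < h i * (Im z * (Re (f i) ^ 2 + Im (f i) ^ 2))"
    using i h[of i] z nz[of i] by (simp add: complex_neq_0 order_less_le)
  also have "\<dots> = h i * Im ((1 + z) * f i * cnj (f i))"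
    by (simp add: algebra_simps power2_eq_square)
  also have "\<dots> \<le> (\<Sum>j\<le>n. h j * Im ((1 + z) * f j * cnj (f i)))"
  proof (rule member_le_sum)
    fix j assume j: "j \<in> {..n} - {i}"
    show "0 \<le> h j * Im ((1 + z) * f j * cnj (f i))"
    proof (cases "h j = 0")
      case False
      then have "i \<le> j" using min j by auto
      then show ?thesis
        using arg_betweenD(1)[OF z f[of i j]] h[of j] j by (intro mult_nonneg_nonneg) auto
    qed simp
  qed (use i in auto)
  also have "\<dots> = Im ((1 + z) * (\<Sum>j\<le>n. complex_of_real (h j) * f j) * cnj (f i))"
    unfolding sum_distrib_left sum_distrib_right Im_sum
    by (intro sum.cong refl) (simp add: algebra_simps)
  finally show False using sum0 by simp
qed

text \<open>Detached from posets so that the same recursion can be used at \<open>cnj z\<close>. The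
  condition \<open>lam_nonzero\<close> keeps a row from collapsing to zero.\<close>

locale chain_recurrence =
  fixes z :: complex and D :: nat and lam :: "nat \<Rightarrow> nat \<Rightarrow> real" and f :: "nat \<Rightarrow> nat \<Rightarrow> complex"
  assumes f00: "f 0 0 = 1"
    and rec: "\<And>n k. n < D \<Longrightarrow> k \<le> Suc n \<Longrightarrow> f (Suc n) k =
      z * (\<Sum>j<k. complex_of_real (lam n j) * f n j) + (1 + z) * (\<Sum>j=k..n. complex_of_real (lam n j) * f n j)"
    and lam_nonneg: "\<And>n k. n < D \<Longrightarrow> k \<le> n \<Longrightarrow> 0 \<le> lam n k"
    and lam_nonzero: "\<And>n. n < D \<Longrightarrow> \<exists>k\<le>n. lam n k \<noteq> 0"
begin

lemma upper_half_plane: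
  assumes z: "0 < Im z"
  shows "n \<le> D \<Longrightarrow> (\<forall>i j. i \<le> j \<longrightarrow> j \<le> n \<longrightarrow> arg_between z (f n i) (f n j)) \<and> (\<forall>i\<le>n. f n i \<noteq> 0)"
proof (induction n)
  case 0
  then show ?case using z by (simp add: f00 arg_between_refl)
next
  case (Suc n)
  then have n: "n < D" by simp
  have IH: "arg_between z (f n i) (f n j)" if "i \<le> j" "j \<le> n" for i j
    using Suc that by simp
  have nz: "f n i \<noteq> 0" if "i \<le> n" for i
    using Suc that by simp
  define S where "S = (\<lambda>I. \<Sum>j\<in>I. complex_of_real (lam n j) * f n j)"
  have S_between: "arg_between z (S I) (S J)"
    if "I \<subseteq> {..n}" "J \<subseteq> {..n}" "\<And>i j. i \<in> I \<Longrightarrow> j \<in> J \<Longrightarrow> i \<le> j" for I J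
    unfolding S_def using that
    by (intro arg_between_sum_left arg_between_sum_right IH lam_nonneg n) (auto simp: subset_iff)
  have f_S: "f (Suc n) k = z * S {..<k} + (1 + z) * S {k..n}" if "k \<le> Suc n" for k
    using rec[OF n that] by (simp add: S_def)
  have "arg_between z (f (Suc n) k) (f (Suc n) l)" if "k \<le> l" "l \<le> Suc n" for k l
  proof -
    have "S {..<l} = S {..<k} + S {k..<l}"
      unfolding S_def using that by (subst sum.union_disjoint[symmetric]) (auto intro!: sum.cong)
    moreover have "S {k..n} = S {k..<l} + S {l..n}"
      unfolding S_def using that by (subst sum.union_disjoint[symmetric]) (auto intro!: sum.cong)
    moreover have "arg_between z (S {..<k}) (S {k..<l})" "arg_between z (S {k..<l}) (S {l..n})"
      "arg_between z (S {..<k}) (S {l..n})"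
      using that by (auto intro!: S_between)
    ultimately show ?thesis
      using arg_between_step[OF z] f_S[of k] f_S[of l] that
      by (simp only: distrib_left[of _ "S _" "S _"] add.assoc)
  qed
  moreover have "f (Suc n) k \<noteq> 0" if k: "k \<le> Suc n" for k
  proof
    assume "f (Suc n) k = 0"
    \<comment> \<open>Since the tail turns counterclockwise from the head, this cancellation forces
      both to vanish, and with them a nontrivial nonnegative combination of row
      \<open>n\<close>.\<close>
    then have 0: "(1 + z) * S {k..n} = - (z * S {..<k})"
      using f_S[OF k] by (simp add: eq_neg_iff_add_eq_0 add.commute)
    have "0 \<le> Im ((1 + z) * S {k..n} * cnj (S {..<k}))"
      using k by (intro arg_betweenD(1) z S_between) auto
    also have "\<dots> = - (Im z * (Re (S {..<k}) ^ 2 + Im (S {..<k}) ^ 2))"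
      unfolding 0 by (simp add: algebra_simps power2_eq_square)
    finally have "S {..<k} = 0"
      using z by (smt (verit) complex_neq_0 mult_pos_pos)
    moreover have "1 + z \<noteq> 0"
      using z by (auto simp: complex_eq_iff)
    moreover from calculation have "S {k..n} = 0"
      using 0 by simp
    moreover have "S {..n} = S {..<k} + S {k..n}"
      unfolding S_def using k by (subst sum.union_disjoint[symmetric]) (auto intro!: sum.cong)
    ultimately have "S {..n} = 0" by simp
    moreover have "S {..n} \<noteq> 0"
      unfolding S_def using nz n IH lam_nonneg lam_nonzero
      by (intro nonneg_combination_nonzero[OF z]) auto
    ultimately show False by simp
  qed
  ultimately show ?case by blast
qed

text \<open>Outside the interval \<open>x\<close> and \<open>1 + x\<close> have the same sign, so
  each new row multiplies the common sign by \<open>sgn x\<close>.\<close>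

lemma outside_interval:
  assumes z: "z = complex_of_real x" "x < -1 \<or> 0 < x"
  shows "n \<le> D \<Longrightarrow> k \<le> n \<Longrightarrow> \<exists>u>0. f n k = complex_of_real (sgn x ^ n * u)"
proof (induction n arbitrary: k)
  case 0
  then show ?case by (auto simp: f00 intro!: exI[of _ 1])
next
  case (Suc n)
  then have n: "n < D" by simp
  have "\<forall>j\<in>{..n}. \<exists>u>0. f n j = complex_of_real (sgn x ^ n * u)"
    using Suc.IH n by simp
  then obtain u where u: "\<And>j. j \<le> n \<Longrightarrow> 0 < u j \<and> f n j = complex_of_real (sgn x ^ n * u j)"
    by (metis atMost_iff bchoice)
  define c where "c j = (if j < k then \<bar>x\<bar> else \<bar>1 + x\<bar>)" for j
  define v where "v = (\<Sum>j\<le>n. c j * lam n j * u j)"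
  have c: "0 < c j" for j
    using z by (auto simp: c_def)
  have "f (Suc n) k = (\<Sum>j<k. z * (complex_of_real (lam n j) * f n j)) + (\<Sum>j=k..n. (1 + z) * (complex_of_real (lam n j) * f n j))"
    using rec[OF n Suc.prems(2)] by (simp add: sum_distrib_left)
  also have "\<dots> = (\<Sum>j<k. complex_of_real (sgn x ^ Suc n * (c j * lam n j * u j)))
     + (\<Sum>j=k..n. complex_of_real (sgn x ^ Suc n * (c j * lam n j * u j)))"
    using Suc.prems(2) z u
    by (intro arg_cong2[of _ _ _ _ "(+)"] sum.cong refl) (auto simp: c_def sgn_if)
  also have "\<dots> = (\<Sum>j\<le>n. complex_of_real (sgn x ^ Suc n * (c j * lam n j * u j)))"
    using Suc.prems(2) by (subst sum.union_disjoint[symmetric]) (auto intro!: sum.cong)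
  also have "\<dots> = complex_of_real (sgn x ^ Suc n * v)"
    by (simp add: v_def sum_distrib_left)
  finally have "f (Suc n) k = complex_of_real (sgn x ^ Suc n * v)" .
  moreover obtain i where i: "i \<le> n" "lam n i \<noteq> 0" using lam_nonzero[OF n] by auto
  have "0 < v"
    unfolding v_def using i u c lam_nonneg[OF n] n
    by (intro sum_pos2[of _ i]) (auto intro!: mult_nonneg_nonneg mult_pos_pos simp: order_less_le)
  ultimately show ?case by blast
qed

end

text \<open>The multipliers are real. This reduces the lower half plane to the upper one.\<close>

lemma chain_recurrence_cnj:
  assumes "chain_recurrence z D lam f"
  shows "chain_recurrence (cnj z) D lam (\<lambda>n k. cnj (f n k))"
proof -
  interpret chain_recurrence z D lam f by fact
  show ?thesis
    by unfold_locales (use f00 rec lam_nonneg lam_nonzero in auto)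
qed

lemma (in chain_recurrence) combination_nonzero:
  assumes z: "z \<notin> complex_of_real ` {-1..0}"
    and h: "\<And>i. i \<le> D \<Longrightarrow> 0 \<le> h i" "\<exists>i\<le>D. h i \<noteq> 0"
  shows "(\<Sum>i\<le>D. complex_of_real (h i) * f D i) \<noteq> 0"
proof -
  consider "0 < Im z" | "Im z < 0" | "Im z = 0" by linarith
  then show ?thesis
  proof cases
    case 1
    then show ?thesis
      using upper_half_plane[of D] h by (intro nonneg_combination_nonzero[of z]) auto
  next
    case 2
    interpret conj: chain_recurrence "cnj z" D lam "\<lambda>n k. cnj (f n k)"
      by (intro chain_recurrence_cnj) unfold_locales
    have "(\<Sum>i\<le>D. complex_of_real (h i) * cnj (f D i)) \<noteq> 0"
      using 2 conj.upper_half_plane[of D] h by (intro nonneg_combination_nonzero[of "cnj z"]) auto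
    also have "(\<Sum>i\<le>D. complex_of_real (h i) * cnj (f D i)) = cnj (\<Sum>i\<le>D. complex_of_real (h i) * f D i)"
      by simp
    finally show ?thesis by (metis complex_cnj_zero_iff)
  next
    case 3
    define x where "x = Re z"
    have zx: "z = complex_of_real x"
      using 3 by (simp add: x_def complex_eq_iff)
    with z have x: "x < -1 \<or> 0 < x" by force
    have "\<forall>k\<in>{..D}. \<exists>u>0. f D k = complex_of_real (sgn x ^ D * u)"
      using outside_interval[OF zx x, of D] by simp
    then obtain u where u: "\<And>k. k \<le> D \<Longrightarrow> 0 < u k \<and> f D k = complex_of_real (sgn x ^ D * u k)"
      by (metis atMost_iff bchoice)
    obtain i where i: "i \<le> D" "h i \<noteq> 0" using h by auto
    have "0 < (\<Sum>k\<le>D. h k * u k)"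
      using i h(1) u by (intro sum_pos2[of _ i]) (auto simp: order_less_le)
    moreover have "(\<Sum>i\<le>D. complex_of_real (h i) * f D i) = complex_of_real (sgn x ^ D * (\<Sum>k\<le>D. h k * u k))"
      unfolding sum_distrib_left of_real_sum using u by (intro sum.cong refl) auto
    ultimately show ?thesis
      using x by (simp only: of_real_eq_0_iff) (auto simp: sgn_if)
  qed
qed

subsection \<open>Quasi-rank and chains\<close>

locale uniform_poset =
  fixes A :: "'a set" and r :: "'a rel"
  assumes uniform: "quasi_rank_uniform A r"
begin

abbreviation rk :: "'a \<Rightarrow> nat" where "rk \<equiv> quasi_rank A r"

lemma
  shows in_carrier: "(x, y) \<in> r \<Longrightarrow> x \<in> A \<and> y \<in> A"
    and le_refl: "x \<in> A \<Longrightarrow> (x, x) \<in> r"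
    and le_antisym: "(x, y) \<in> r \<Longrightarrow> (y, x) \<in> r \<Longrightarrow> x = y"
    and le_trans: "(x, y) \<in> r \<Longrightarrow> (y, w) \<in> r \<Longrightarrow> (x, w) \<in> r"
    and ex_bot: "\<exists>b\<in>A. \<forall>x\<in>A. (b, x) \<in> r"
    and finite_interval: "x \<in> A \<Longrightarrow> y \<in> A \<Longrightarrow> finite {w \<in> A. (x, w) \<in> r \<and> (w, y) \<in> r}"
    and finite_chain_lengths: "x \<in> A \<Longrightarrow> finite (chain_lengths_below A r x)"
  using uniform
  unfolding quasi_rank_uniform_def locally_finite_poset_def partial_order_on_def preorder_on_def
  by (auto simp: refl_on_def dest: antisymD transD)

lemma finite_under: "finite (under r x)"
proof (cases "x \<in> A")
  case True
  obtain b where "b \<in> A" "\<forall>x\<in>A. (b, x) \<in> r" using ex_bot by blast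
  then have "under r x \<subseteq> {w \<in> A. (b, w) \<in> r \<and> (w, x) \<in> r}"
    using in_carrier by (auto simp: under_def)
  then show ?thesis using finite_interval[OF \<open>b \<in> A\<close> True] finite_subset by blast
next
  case False
  then have "under r x = {}" using in_carrier by (auto simp: under_def)
  then show ?thesis by simp
qed

lemma ex_rk_chain:
  assumes "x \<in> A"
  shows "\<exists>c. (\<forall>i\<le>rk x. c i \<in> A) \<and> (\<forall>i<rk x. (c i, c (Suc i)) \<in> r \<and> c i \<noteq> c (Suc i)) \<and> c (rk x) = x"
proof -
  have "0 \<in> chain_lengths_below A r x"
    using assms by (auto simp: chain_lengths_below_def intro: exI[of _ "\<lambda>_. x"])
  then have "rk x \<in> chain_lengths_below A r x"
    unfolding quasi_rank_def using finite_chain_lengths[OF assms] by (intro Max_in) auto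
  then show ?thesis unfolding chain_lengths_below_def by blast
qed

lemma rk_ge:
  assumes "\<And>i. i \<le> k \<Longrightarrow> c i \<in> A" "\<And>i. i < k \<Longrightarrow> (c i, c (Suc i)) \<in> r \<and> c i \<noteq> c (Suc i)"
  shows "k \<le> rk (c k)"
  unfolding quasi_rank_def
  using assms by (intro Max_ge finite_chain_lengths) (auto simp: chain_lengths_below_def)

lemma rk_less:
  assumes "(x, y) \<in> r" "x \<noteq> y"
  shows "rk x < rk y"
proof -
  have xy: "x \<in> A" "y \<in> A" using assms in_carrier by auto
  obtain c where c: "\<And>i. i \<le> rk x \<Longrightarrow> c i \<in> A"
    "\<And>i. i < rk x \<Longrightarrow> (c i, c (Suc i)) \<in> r \<and> c i \<noteq> c (Suc i)" "c (rk x) = x"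
    using ex_rk_chain[OF xy(1)] by blast
  have "Suc (rk x) \<le> rk ((c(Suc (rk x) := y)) (Suc (rk x)))"
    using c xy assms by (intro rk_ge) (auto simp: less_Suc_eq le_Suc_eq)
  then show ?thesis by simp
qed

text \<open>The last but one element of a longest chain has rank at least \<open>m\<close> by the
  chain leading to it, and less than \<open>Suc m\<close> because it lies strictly below
  \<open>x\<close>.\<close>

lemma ex_predecessor:
  assumes "x \<in> A" "rk x = Suc m"
  shows "\<exists>y\<in>A. rk y = m"
proof -
  obtain c where c: "\<And>i. i \<le> rk x \<Longrightarrow> c i \<in> A"
    "\<And>i. i < rk x \<Longrightarrow> (c i, c (Suc i)) \<in> r \<and> c i \<noteq> c (Suc i)" "c (rk x) = x"
    using ex_rk_chain[OF assms(1)] by blast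
  have "m \<le> rk (c m)" using c assms by (intro rk_ge) auto
  moreover have "rk (c m) < rk x" using rk_less[of "c m" x] c(2)[of m] c(3) assms by auto
  ultimately have "rk (c m) = m" using assms by simp
  then show ?thesis using c(1)[of m] assms by auto
qed

lemma ex_rk_below: "x \<in> A \<Longrightarrow> n \<le> rk x \<Longrightarrow> \<exists>y\<in>A. rk y = n"
proof (induction "rk x" arbitrary: x)
  case (Suc m)
  then show ?case using ex_predecessor[of x m] by (metis le_Suc_eq)
qed auto

lemma rk_le_poset_rank: "x \<in> A \<Longrightarrow> enat (rk x) \<le> poset_rank A r"
  unfolding poset_rank_def by (rule SUP_upper)

text \<open>Ranks have no gaps, so a missing value \<open>n\<close> would bound all ranks by
  \<open>n - 1\<close>. Hence the choice in \<open>rank_matrix\<close> is meaningful.\<close>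

lemma ex_rk:
  assumes "enat n \<le> poset_rank A r"
  shows "\<exists>x\<in>A. rk x = n"
proof (rule ccontr)
  assume neg: "\<not> (\<exists>x\<in>A. rk x = n)"
  then have less: "rk x < n" if "x \<in> A" for x
    using ex_rk_below[OF that, of n] that by force
  have "0 < n" using less ex_bot by force
  have "poset_rank A r \<le> enat (n - 1)"
    unfolding poset_rank_def using less by (intro SUP_least) force
  also have "\<dots> < enat n" using \<open>0 < n\<close> by simp
  finally show False using assms by simp
qed

lemma ex_bot_rk: "\<exists>b\<in>A. (\<forall>x\<in>A. (b, x) \<in> r) \<and> (\<forall>x\<in>A. rk x = 0 \<longleftrightarrow> x = b)"
proof -
  obtain b where b: "b \<in> A" "\<And>x. x \<in> A \<Longrightarrow> (b, x) \<in> r" using ex_bot by blast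
  obtain x where x: "x \<in> A" "rk x = 0" using ex_rk_below[OF b(1), of 0] by auto
  have bot: "w = b" if "w \<in> A" "rk w = 0" for w
    using rk_less[of b w] b(2)[of w] that by auto
  with x have "rk b = 0" by auto
  then show ?thesis using b bot by blast
qed

lemma rank_matrix_level:
  assumes "enat n \<le> poset_rank A r"
  obtains x where "x \<in> A" "rk x = n" "\<And>k. rank_matrix A r n k = real (card (level_below A r x k))"
  using someI_ex[of "\<lambda>x. x \<in> A \<and> rk x = n"] ex_rk[OF assms] that
  unfolding rank_matrix_def by blast

text \<open>Elimination starts from the triangular shape with unit diagonal. The ones in column 0
  come from the least element and later keep a row of multipliers from vanishing.\<close>

lemma
  assumes n: "enat n \<le> poset_rank A r"
  shows rank_matrix_upper: "n < k \<Longrightarrow> rank_matrix A r n k = 0"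
    and rank_matrix_diag: "rank_matrix A r n n = 1"
    and rank_matrix_0: "rank_matrix A r n 0 = 1"
proof -
  obtain x where x: "x \<in> A" "rk x = n" "\<And>k. rank_matrix A r n k = real (card (level_below A r x k))"
    by (rule rank_matrix_level[OF n]) (rule that; blast)
  have le: "rk w < n" if "w \<in> under r x" "w \<noteq> x" for w
    using rk_less[of w x] that x by (auto simp: under_def)
  then have "level_below A r x k = {}" if "n < k" for k
    using x that unfolding level_below_def by (auto dest: order.asym)
  then show "n < k \<Longrightarrow> rank_matrix A r n k = 0"
    by (simp add: x)
  have "w = x" if "w \<in> level_below A r x n" for w
    using le[of w] that by (auto simp: level_below_def)
  then have "level_below A r x n = {x}"
    using x le_refl[of x] by (auto simp: level_below_def under_def)
  then show "rank_matrix A r n n = 1" by (simp add: x)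
  obtain b where "b \<in> A" "\<And>x. x \<in> A \<Longrightarrow> (b, x) \<in> r" "\<And>x. x \<in> A \<Longrightarrow> rk x = 0 \<longleftrightarrow> x = b"
    using ex_bot_rk by auto
  then have "level_below A r x 0 = {b}"
    using x in_carrier unfolding level_below_def by (auto simp: under_def)
  then show "rank_matrix A r n 0 = 1" by (simp add: x)
qed

lemma finite_chain_has_max:
  assumes "C \<in> Chains r" "finite C" "C \<noteq> {}"
  obtains y where "y \<in> C" "C - {y} \<subseteq> underS r y"
proof -
  have "Max (rk ` C) \<in> rk ` C"
    using assms by (intro Max_in) auto
  then obtain y where "y \<in> C" and max: "rk y = Max (rk ` C)"
    by auto
  then have y: "y \<in> C" "\<And>x. x \<in> C \<Longrightarrow> rk x \<le> rk y"
    using assms(2) by (auto intro: Max_ge)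
  have "C - {y} \<subseteq> underS r y"
    using y rk_less assms(1) unfolding Chains_def underS_def by (fastforce dest: leD)
  then show ?thesis using that y by blast
qed

section \<open>Chains counted by their maximum\<close>

definition chain_sum :: "complex \<Rightarrow> 'a set \<Rightarrow> complex" where
  "chain_sum z S = (\<Sum>C | C \<subseteq> S \<and> C \<in> Chains r. z ^ card C)"

text \<open>The 1 is the empty chain; any other chain is its maximum \<open>y\<close> together with
  a chain strictly below \<open>y\<close>.\<close>

lemma chain_sum_by_max:
  assumes S: "finite S" "S \<subseteq> A"
  shows "chain_sum z S = 1 + (\<Sum>y\<in>S. z * chain_sum z (S \<inter> underS r y))"
proof -
  define K where "K S = {C. C \<subseteq> S \<and> C \<in> Chains r}" for S
  have fin: "finite (K T)" if "T \<subseteq> S" for T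
    using that S finite_subset[of "K T" "Pow S"] by (auto simp: K_def)
  define I where "I y = insert y ` K (S \<inter> underS r y)" for y
  have "K S = insert {} (\<Union>y\<in>S. I y)"
  proof (intro equalityI subsetI)
    fix C assume C: "C \<in> K S"
    show "C \<in> insert {} (\<Union>y\<in>S. I y)"
    proof (cases "C = {}")
      case False
      moreover have "finite C" using C S by (auto simp: K_def intro: finite_subset)
      ultimately obtain y where y: "y \<in> C" "C - {y} \<subseteq> underS r y"
        using C finite_chain_has_max by (auto simp: K_def)
      then have "C - {y} \<in> K (S \<inter> underS r y)" "C = insert y (C - {y})"
        using C by (auto simp: K_def Chains_def)
      then have "C \<in> I y"
        unfolding I_def by (metis imageI)
      moreover have "y \<in> S" using y C by (auto simp: K_def)
      ultimately show ?thesis by blast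
    qed simp
  next
    fix C assume "C \<in> insert {} (\<Union>y\<in>S. I y)"
    then show "C \<in> K S"
      using S le_refl by (auto simp: I_def K_def Chains_def underS_def subset_iff)
  qed
  moreover have "{} \<notin> (\<Union>y\<in>S. I y)" by (auto simp: I_def)
  ultimately have "chain_sum z S = 1 + (\<Sum>C\<in>(\<Union>y\<in>S. I y). z ^ card C)"
    using S fin by (simp add: chain_sum_def K_def[symmetric] I_def)
  also have "(\<Sum>C\<in>(\<Union>y\<in>S. I y). z ^ card C) = (\<Sum>y\<in>S. \<Sum>C\<in>I y. z ^ card C)"
  proof (rule sum.UNION_disjoint)
    have "x = y" if "C \<in> I x" "C \<in> I y" for C x y
    proof (rule ccontr)
      assume "x \<noteq> y"
      moreover have "y \<in> C" "x \<in> C" "C - {x} \<subseteq> underS r x" "C - {y} \<subseteq> underS r y"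
        using that by (auto simp: I_def K_def)
      ultimately have "(x, y) \<in> r" "(y, x) \<in> r" by (auto simp: underS_def)
      then show False using le_antisym \<open>x \<noteq> y\<close> by blast
    qed
    then show "\<forall>i\<in>S. \<forall>j\<in>S. i \<noteq> j \<longrightarrow> I i \<inter> I j = {}" by blast
  qed (use S fin in \<open>auto simp: I_def\<close>)
  also have "\<dots> = (\<Sum>y\<in>S. z * chain_sum z (S \<inter> underS r y))"
  proof (rule sum.cong)
    fix y assume "y \<in> S"
    have notin: "y \<notin> C" if "C \<in> K (S \<inter> underS r y)" for C
      using that by (auto simp: K_def underS_def)
    have "(\<Sum>C\<in>I y. z ^ card C) = (\<Sum>C\<in>K (S \<inter> underS r y). z ^ card (insert y C))"
      unfolding I_def using insert_ident[OF notin notin]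
      by (subst sum.reindex) (auto intro: inj_onI)
    also have "\<dots> = (\<Sum>C\<in>K (S \<inter> underS r y). z * z ^ card C)"
    proof (rule sum.cong)
      fix C assume C: "C \<in> K (S \<inter> underS r y)"
      then have "finite C" using S by (auto simp: K_def intro: finite_subset)
      then show "z ^ card (insert y C) = z * z ^ card C" using notin[OF C] by simp
    qed simp
    finally show "(\<Sum>C\<in>I y. z ^ card C) = z * chain_sum z (S \<inter> underS r y)"
      by (simp add: chain_sum_def K_def sum_distrib_left)
  qed simp
  finally show ?thesis .
qed

text \<open>
  \<open>g\<close> is the generating function, by number of elements, of the chains avoiding the least element
  whose maximum is a given element of positive quasi-rank. Adding the least element to such a
  chain or not accounts for the factor \<open>1 + z\<close>.
\<close>

lemma chain_sum_eq:
  fixes g :: "nat \<Rightarrow> complex"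
  assumes fin: "finite A" and g0: "g 0 = 1"
    and g: "\<And>y. y \<in> A \<Longrightarrow> 0 < rk y \<Longrightarrow> g (rk y) = z * (\<Sum>x\<in>underS r y. g (rk x))"
  shows "chain_sum z A = (1 + z) * (\<Sum>y\<in>A. g (rk y))"
proof -
  obtain b where b: "b \<in> A" "\<And>x. x \<in> A \<Longrightarrow> (b, x) \<in> r" "\<And>x. x \<in> A \<Longrightarrow> rk x = 0 \<longleftrightarrow> x = b"
    using ex_bot_rk by auto
  \<comment> \<open>Kept general in the down-closed set \<open>S\<close>: the induction needs strict
    ideals, the conclusion all of \<open>A\<close>.\<close>
  have step: "chain_sum z S = (1 + z) * (\<Sum>x\<in>S. g (rk x))"
    if S: "S \<subseteq> A" "b \<in> S" "\<And>x. x \<in> S \<Longrightarrow> underS r x \<subseteq> S"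
      and IH: "\<And>x. x \<in> S \<Longrightarrow> z * chain_sum z (underS r x) = (1 + z) * g (rk x) - (if x = b then 1 else 0)"
    for S
  proof -
    have finS: "finite S" using S(1) fin finite_subset by blast
    have "chain_sum z S = 1 + (\<Sum>x\<in>S. z * chain_sum z (S \<inter> underS r x))"
      by (rule chain_sum_by_max[OF finS S(1)])
    also have "(\<Sum>x\<in>S. z * chain_sum z (S \<inter> underS r x)) = (\<Sum>x\<in>S. (1 + z) * g (rk x) - (if x = b then 1 else 0))"
      using S(3) IH by (intro sum.cong refl) (simp add: Int_absorb1)
    also have "\<dots> = (1 + z) * (\<Sum>x\<in>S. g (rk x)) - 1"
      using finS S(2) by (simp add: sum_subtractf sum_distrib_left)
    finally show ?thesis by simp
  qed
  \<comment> \<open>The left side counts the chains with maximum \<open>y\<close>. At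
    \<open>y = b\<close> it is \<open>z\<close> instead of \<open>1 + z\<close>; summed over
    \<open>y\<close>, this correction cancels the empty chain.\<close>
  have under: "z * chain_sum z (underS r y) = (1 + z) * g (rk y) - (if y = b then 1 else 0)" if "y \<in> A" for y
    using that
  proof (induction "rk y" arbitrary: y rule: less_induct)
    case less
    show ?case
    proof (cases "y = b")
      case True
      have "x = b" if "(x, b) \<in> r" for x
        using le_antisym[OF that] b(2) in_carrier[OF that] by blast
      then have "underS r y = {}"
        using True by (auto simp: underS_def)
      then have "chain_sum z (underS r y) = 1"
        using chain_sum_by_max[of "{}" z] by simp
      moreover have "rk y = 0" using True b by simp
      ultimately show ?thesis using True g0 by simp
    next
      case False
      have sub: "underS r x \<subseteq> underS r y" if "x \<in> underS r y" for x
        using that le_trans[of _ x y] le_antisym[of x y] by (auto simp: underS_def)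
      have "chain_sum z (underS r y) = (1 + z) * (\<Sum>x\<in>underS r y. g (rk x))"
      proof (rule step)
        show "underS r y \<subseteq> A"
          using in_carrier by (auto simp: underS_def)
        show "b \<in> underS r y"
          using False b(2)[OF less.prems] by (auto simp: underS_def)
        fix x assume x: "x \<in> underS r y"
        then have "rk x < rk y" "x \<in> A"
          using rk_less in_carrier by (auto simp: underS_def)
        then show "z * chain_sum z (underS r x) = (1 + z) * g (rk x) - (if x = b then 1 else 0)"
          by (rule less.hyps)
      qed (rule sub)
      then show ?thesis
        using False g[OF less.prems] b(3)[OF less.prems] by simp
    qed
  qed
  have "underS r x \<subseteq> A" for x
    using in_carrier by (auto simp: underS_def)
  then show ?thesis
    using b(1) under by (intro step) auto
qed

lemma poly_chain_poly:
  "poly (map_poly complex_of_real (chain_poly A r)) z = chain_sum z A"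
proof -
  have "map_poly complex_of_real (sum F K) = (\<Sum>i\<in>K. map_poly complex_of_real (F i))"
    for F :: "'a set \<Rightarrow> real poly" and K
    by (intro poly_eqI) (simp add: coeff_map_poly coeff_sum)
  then show ?thesis
    by (simp add: chain_poly_def chain_sum_def X_power_eq_monom map_poly_monom poly_sum poly_monom)
qed

end

subsection \<open>Zeros of the chain polynomial\<close>

lemma R_poly_is_R_array:
  assumes "TN_poset A r"
  shows "\<exists>lam. is_R_array (poset_rank A r) (rank_matrix A r) lam (poset_R_poly A r)"
proof -
  interpret uniform_poset A r
    using assms by unfold_locales (simp add: TN_poset_def)
  have "consecutive_TN (poset_rank A r) 0 (rank_matrix A r)"
    using assms rank_matrix_upper rank_matrix_diag
    by (intro totally_nonnegative_imp_consecutive_TN) (auto simp: TN_poset_def)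
  then show ?thesis
    unfolding poset_R_poly_def R_poly_def by (intro someI_ex[of "\<lambda>R. \<exists>lam. is_R_array _ _ lam R"] is_R_array_exists)
qed

text \<open>Removing the maximum leaves a chain whose own maximum has some rank
  \<open>k < n\<close>, with \<open>M n k\<close> candidates for it. The value 1 at 0 lets the term
  \<open>k = 0\<close> stand for the empty remainder when \<open>M n 0 = 1\<close>.\<close>

fun rank_chain_gf :: "(nat \<Rightarrow> nat \<Rightarrow> real) \<Rightarrow> complex \<Rightarrow> nat \<Rightarrow> complex" where
  "rank_chain_gf M z n =
     (if n = 0 then 1 else z * (\<Sum>k<n. complex_of_real (M n k) * rank_chain_gf M z k))"

declare rank_chain_gf.simps [simp del]

text \<open>The cutoff \<open>D\<close> makes the summation range independent of \<open>p\<close>,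
  so that linearity is immediate.\<close>

definition coeff_functional :: "nat \<Rightarrow> (nat \<Rightarrow> complex) \<Rightarrow> real poly \<Rightarrow> complex" where
  "coeff_functional D g p = (\<Sum>j\<le>D. complex_of_real (coeff p j) * g j)"

lemma coeff_functional_add:
  "coeff_functional D g (p + q) = coeff_functional D g p + coeff_functional D g q"
  by (simp add: coeff_functional_def distrib_right sum.distrib)

lemma coeff_functional_smult:
  "coeff_functional D g (smult c p) = complex_of_real c * coeff_functional D g p"
  by (simp add: coeff_functional_def sum_distrib_left mult.assoc)

lemma coeff_functional_sum:
  "coeff_functional D g (sum F K) = (\<Sum>i\<in>K. coeff_functional D g (F i))"
  unfolding coeff_functional_def coeff_sum of_real_sum sum_distrib_right by (rule sum.swap)

lemma coeff_functional_X_power: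
  assumes "n \<le> D"
  shows "coeff_functional D g ([:0, 1:] ^ n) = g n"
proof -
  have "coeff_functional D g ([:0, 1:] ^ n) = (\<Sum>j\<le>D. if j = n then g n else 0)"
    unfolding coeff_functional_def X_power_eq_monom by (intro sum.cong) auto
  then show ?thesis using assms by simp
qed

text \<open>Telescoping in \<open>k\<close> gives the value at \<open>(Suc n, k)\<close> as
  \<open>rank_chain_gf M z (Suc n)\<close> plus the weighted sum over \<open>j \<ge> k\<close>.
  Comparing \<open>k = 0\<close> with row \<open>Suc n\<close> of \<open>M\<close> shows the first
  summand to be \<open>z\<close> times the full weighted sum.\<close>

lemma chain_recurrence_R_array:
  assumes R: "is_R_array N M lam R" and D: "enat D \<le> N" and M0: "\<And>n. enat n \<le> N \<Longrightarrow> M n 0 = 1"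
    and M1: "\<And>n. enat n \<le> N \<Longrightarrow> M n n = 1"
  shows "chain_recurrence z D lam (\<lambda>n k. coeff_functional D (rank_chain_gf M z) (R n k))"
proof -
  let ?g = "rank_chain_gf M z"
  let ?L = "coeff_functional D ?g"
  have nN: "enat n \<le> N" if "n \<le> D" for n
    using D that by (metis enat_ord_simps(1) order_trans)
  have nN': "enat n < N" if "n < D" for n
    using nN[of "Suc n"] that by (simp add: Suc_ile_eq)
  have Rnn: "R n n = [:0, 1:] ^ n" and Rn0: "R n 0 = (\<Sum>k\<le>n. smult (M n k) ([:0, 1:] ^ k))" if "n \<le> D" for n
    using R nN[OF that] unfolding is_R_array_def by blast+
  have lam: "0 \<le> lam n k" and rec: "R (Suc n) k = R (Suc n) (Suc k) + smult (lam n k) (R n k)"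
    if "n < D" "k \<le> n" for n k
    using R nN'[OF that(1)] that unfolding is_R_array_def by blast+
  have tele: "R (Suc n) k = [:0, 1:] ^ Suc n + (\<Sum>j=k..n. smult (lam n j) (R n j))"
    if n: "n < D" and k: "k \<le> Suc n" for n k
    using k
  proof (induction k rule: inc_induct)
    case base
    then show ?case using Rnn[of "Suc n"] n by simp
  next
    case (step k)
    then show ?case using rec[OF n, of k] by (simp add: sum.atLeast_Suc_atMost)
  qed
  show ?thesis
  proof
    show "?L (R 0 0) = 1"
      using Rnn[of 0] coeff_functional_X_power[of 0 D ?g] by (simp add: rank_chain_gf.simps)
  next
    fix n k assume n: "n < D" and k: "k \<le> Suc n"
    define S where "S I = (\<Sum>j\<in>I. complex_of_real (lam n j) * ?L (R n j))" for I
    have L: "?L (R (Suc n) k) = ?g (Suc n) + S {k..n}" if "k \<le> Suc n" for k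
      using n by (simp add: tele[OF n that] coeff_functional_add coeff_functional_sum coeff_functional_smult
          coeff_functional_X_power S_def del: power_Suc)
    have "?L (R (Suc n) 0) = (\<Sum>k\<le>Suc n. complex_of_real (M (Suc n) k) * ?g k)"
      using n by (simp add: Rn0 coeff_functional_sum coeff_functional_smult coeff_functional_X_power
          del: sum.atMost_Suc)
    also have "\<dots> = (\<Sum>k<Suc n. complex_of_real (M (Suc n) k) * ?g k) + complex_of_real (M (Suc n) (Suc n)) * ?g (Suc n)"
      by (simp add: lessThan_Suc_atMost)
    also have "M (Suc n) (Suc n) = 1"
      using M1[OF nN, of "Suc n"] n by simp
    finally have "S {0..n} = (\<Sum>k<Suc n. complex_of_real (M (Suc n) k) * ?g k)"
      using L[of 0] by simp
    then have "?g (Suc n) = z * S {0..n}"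
      by (subst rank_chain_gf.simps) simp
    also have "S {0..n} = S {..<k} + S {k..n}"
      unfolding S_def using k by (subst sum.union_disjoint[symmetric]) (auto intro!: sum.cong)
    finally show "?L (R (Suc n) k) = z * S {..<k} + (1 + z) * S {k..n}"
      using L[OF k] by (simp add: algebra_simps)
  next
    fix n assume n: "n < D"
    show "\<exists>k\<le>n. lam n k \<noteq> 0"
    proof (rule ccontr)
      assume "\<not> ?thesis"
      \<comment> \<open>A pure power has constant term 0, but the constant term here is
        \<open>M (Suc n) 0 = 1\<close>.\<close>
      then have "R (Suc n) 0 = [:0, 1:] ^ Suc n"
        using tele[OF n, of 0] by simp
      then have "coeff (R (Suc n) 0) 0 = 0" by simp
      moreover have "coeff (R (Suc n) 0) 0 = M (Suc n) 0"
        using n by (simp add: Rn0 coeff_sum X_power_eq_monom smult_monom del: sum.atMost_Suc)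
      ultimately show False using M0[OF nN, of "Suc n"] n by simp
    qed
  qed (use lam in auto)
qed

theorem theorem6p6:
  fixes P :: "'a set" and leP :: "'a rel"
    and Q :: "'b set" and leQ :: "'b rel"
  assumes "TN_poset P leP"
    and "finite Q"
    and "P_positive P leP Q leQ"
  shows "\<forall>z::complex. poly (map_poly complex_of_real (chain_poly Q leQ)) z = 0 \<longrightarrow>
           z \<in> complex_of_real ` {-1..0}"
proof (intro allI impI, rule ccontr)
  fix z :: complex
  assume root: "poly (map_poly complex_of_real (chain_poly Q leQ)) z = 0"
    and z: "z \<notin> complex_of_real ` {-1..0}"
  interpret P: uniform_poset P leP
    using assms by unfold_locales (simp add: TN_poset_def)
  interpret Q: uniform_poset Q leQ
    using assms by unfold_locales (simp add: P_positive_def combinatorial_poset_def)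
  let ?N = "poset_rank P leP" and ?M = "rank_matrix P leP" and ?R = "poset_R_poly P leP"
  obtain lam where R: "is_R_array ?N ?M lam ?R"
    using R_poly_is_R_array[OF assms(1)] by blast
  obtain D h where D: "poset_rank Q leQ = enat D" and h: "\<And>k. k \<le> D \<Longrightarrow> 0 \<le> h k"
    and f_Q: "f_poly Q leQ = (\<Sum>k\<le>D. smult (h k) (?R D k))"
    using assms(3) unfolding P_positive_def by blast
  have DN: "enat D \<le> ?N" and
    ideal: "\<And>y. y \<in> Q \<Longrightarrow> (\<Sum>x\<in>under leQ y. [:0, 1:] ^ Q.rk x) = ?R (Q.rk y) 0"
    using assms(3) D unfolding P_positive_def combinatorial_poset_def by auto
  have rk_D: "Q.rk y \<le> D" if "y \<in> Q" for y
    using Q.rk_le_poset_rank[OF that] D by simp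
  let ?g = "rank_chain_gf ?M z"
  let ?L = "coeff_functional D ?g"
  interpret chain_recurrence z D lam "\<lambda>n k. ?L (?R n k)"
    using chain_recurrence_R_array[OF R DN] P.rank_matrix_0 P.rank_matrix_diag by blast
  \<comment> \<open>Principal ideals of \<open>Q\<close> have the rank generating polynomials
    prescribed by \<open>P\<close>, so the function built from the rank matrix of \<open>P\<close>
    also counts chains in \<open>Q\<close>.\<close>
  have "?g (Q.rk y) = z * (\<Sum>x\<in>underS leQ y. ?g (Q.rk x))" if y: "y \<in> Q" "0 < Q.rk y" for y
  proof -
    define m where "m = Q.rk y"
    have m: "m \<le> D" using rk_D y by (simp add: m_def)
    then have mN: "enat m \<le> ?N" using DN by (metis enat_ord_simps(1) order_trans)
    have under: "under leQ y = insert y (underS leQ y)"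
      using Q.le_refl[OF y(1)] by (auto simp: under_def underS_def)
    have "?g m + (\<Sum>x\<in>underS leQ y. ?g (Q.rk x)) = (\<Sum>x\<in>under leQ y. ?g (Q.rk x))"
      using Q.finite_under[of y] unfolding under by (subst sum.insert) (auto simp: underS_def m_def)
    also have "\<dots> = ?L (\<Sum>x\<in>under leQ y. [:0, 1:] ^ Q.rk x)"
      unfolding coeff_functional_sum using rk_D Q.in_carrier
      by (intro sum.cong refl coeff_functional_X_power[symmetric]) (auto simp: under_def)
    also have "\<dots> = ?L (?R m 0)"
      using ideal[OF y(1)] by (simp add: m_def)
    also have "?R m 0 = (\<Sum>k\<le>m. smult (?M m k) ([:0, 1:] ^ k))"
      using R mN unfolding is_R_array_def by blast
    also have "?L \<dots> = (\<Sum>k\<le>m. complex_of_real (?M m k) * ?g k)"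
      using m by (simp add: coeff_functional_sum coeff_functional_smult coeff_functional_X_power)
    also have "\<dots> = ?g m + (\<Sum>k<m. complex_of_real (?M m k) * ?g k)"
      using P.rank_matrix_diag[OF mN] by (simp add: lessThan_Suc_atMost[symmetric])
    finally have "(\<Sum>x\<in>underS leQ y. ?g (Q.rk x)) = (\<Sum>k<m. complex_of_real (?M m k) * ?g k)"
      by simp
    then show ?thesis
      using y by (subst rank_chain_gf.simps) (simp add: m_def)
  qed
  then have "Q.chain_sum z Q = (1 + z) * (\<Sum>y\<in>Q. ?g (Q.rk y))"
    using assms(2) by (intro Q.chain_sum_eq) (auto simp: rank_chain_gf.simps)
  also have "(\<Sum>y\<in>Q. ?g (Q.rk y)) = ?L (f_poly Q leQ)"
    using rk_D by (simp add: f_poly_def coeff_functional_sum coeff_functional_X_power)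
  also have "\<dots> = (\<Sum>k\<le>D. complex_of_real (h k) * ?L (?R D k))"
    by (simp add: f_Q coeff_functional_sum coeff_functional_smult)
  finally have "(1 + z) * (\<Sum>k\<le>D. complex_of_real (h k) * ?L (?R D k)) = 0"
    using root by (simp add: Q.poly_chain_poly)
  moreover have "1 + z \<noteq> 0"
  proof
    assume "1 + z = 0"
    then have "z = complex_of_real (-1)" by (simp add: add_eq_0_iff)
    then show False using z by force
  qed
  \<comment> \<open>Otherwise \<open>f_poly Q leQ\<close> would be zero, but its value at 1 is the
    number of elements of the nonempty set \<open>Q\<close>.\<close>
  moreover have "\<exists>k\<le>D. h k \<noteq> 0"
  proof (rule ccontr)
    assume "\<not> ?thesis"
    then have "poly (f_poly Q leQ) 1 = 0" by (simp add: f_Q poly_sum)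
    moreover have "poly (f_poly Q leQ) 1 = real (card Q)" by (simp add: f_poly_def poly_sum)
    ultimately show False using Q.ex_bot assms(2) by auto
  qed
  ultimately show False
    using combination_nonzero[OF z] h by simp
qed

end
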